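(* Fix $0<v_1<v_2$, $0<w_1<w_2$ with $v_2<w_2$, and $q>0$. Let $h_q(v)=p(q/v)+v$ for $v>0$, and assume that there exists $\bar v\in[v_1,v_2]$ such that $h_q(\bar v)<w_2$. Then the set $$\mathcal D_{v_1,v_2,w_1,w_2}=\{(\rho,v)\in\mathcal D:\ v_1\le v\le v_2,\ w_1\le v+p(\rho)\le w_2\}$$ is invariant for the Riemann solver $\mathcal{RS}^q_1$ if and only if $$h_q(v_1)\ge w_2\quad\text{and}\quad h_q(v_2)\ge w_2 .$$
   Context: Pressure. $p\in C^2([0,+\infty);[0,+\infty))$ satisfies $p(0)=0$, $p'(\rho)>0$ for all $\rho>0$, and $\rho\mapsto\rho p(\rho)$ is strictly convex. System. $\mathcal D=\mathbb R^+\times\mathbb R^+$ with $\mathbb R^+=[0,+\infty)$; states are $(\rho,v)\in\mathcal D$. The Aw-Rascle system is $\partial_t\rho+\partial_x(\rho v)=0$, $\partial_t(\rho(v+p(\rho)))+\partial_x(\rho v(v+p(\rho)))=0$. Write $f_1(\rho,v)=\rho v$ and $\lambda_1(\rho,v)=v-\rho p'(\rho)$. Classical Riemann solver. For $(\rho^l,v^l),(\rho^r,v^r)\in\mathcal D$, $\mathcal{RS}((\rho^l,v^l),(\rho^r,v^r))$ is the function of $x\in\mathbb R$ (the unconstrained self-similar solution at time $t=1$ with left/right initial states separated at $x=0$) defined a.e. as follows, with $w^l=v^l+p(\rho^l)$. Let $I_2=\{\rho\ge0:\ v^l+p(\rho^l)-p(\rho)=v^r\}$; the intermediate state in cases (a)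 and (b) is $(\rho^m,v^m)$ with $\rho^m=\max I_2$, $v^m=v^r$. (a) If $v^r\le v^l$: it equals $(\rho^l,v^l)$ for $x<\sigma$, $(\rho^m,v^m)$ for $\sigma<x<v^r$, $(\rho^r,v^r)$ for $x>v^r$, where $\sigma=(\rho^mv^m-\rho^lv^l)/(\rho^m-\rho^l)$ if $\rho^m\ne\rho^l$; if $\rho^m=\rho^l$ it equals $(\rho^l,v^l)$ for $x<v^r$ and $(\rho^r,v^r)$ for $x>v^r$. (b) If $v^l<v^r\le w^l$: it equals $(\rho^l,v^l)$ for $x<\lambda_1(\rho^l,v^l)$; for $\lambda_1(\rho^l,v^l)\le x\le\lambda_1(\rho^m,v^m)$ it is the unique state $(\rho,\,w^l-p(\rho))$ with $\rho^m\le\rho\le\rho^l$ and $\lambda_1(\rho,w^l-p(\rho))=x$; $(\rho^m,v^m)$ for $\lambda_1(\rho^m,v^m)<x<v^r$; $(\rho^r,v^r)$ for $x>v^r$. (c) If $v^r>w^l$ (vacuum): it equals $(\rho^l,v^l)$ for $x<\lambda_1(\rho^l,v^l)$; for $\lambda_1(\rho^l,v^l)\le x\le w^l$ it is the state $(\rho,w^l-p(\rho))$ with $0\le\rho\le\rho^l$ and $\lambda_1=x$; $(0,x)$ for $w^l<x<v^r$; $(\rho^r,v^r)$ for $x>v^r$. $f_1(\mathcal{RS}(\cdot,\cdot)(0))$ denotes the common value of $f_1$ at the one-sided traces at $x=0$. Constrained solver $\mathcal{RS}^q_1$. Given $q>0$ and the left state, let $I_1=\{\rho\ge0:\ \rho\,(v^l+p(\rho^l)-p(\rho))=q\}$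 and, when $I_1\neq\emptyset$, $\hat\rho=\max I_1$, $\hat v=q/\hat\rho$, $\check\rho_1=\min I_1$, $\check v_1=q/\check\rho_1$. If $f_1(\mathcal{RS}((\rho^l,v^l),(\rho^r,v^r))(0))\le q$, then $\mathcal{RS}^q_1((\rho^l,v^l),(\rho^r,v^r))=\mathcal{RS}((\rho^l,v^l),(\rho^r,v^r))$. Otherwise $\mathcal{RS}^q_1((\rho^l,v^l),(\rho^r,v^r))(x)$ equals $\mathcal{RS}((\rho^l,v^l),(\hat\rho,\hat v))(x)$ for $x<0$ and $\mathcal{RS}((\check\rho_1,\check v_1),(\rho^r,v^r))(x)$ for $x>0$. Invariance. A set $E\subseteq\mathcal D$ is invariant for a Riemann solver if, whenever both the left and the right states belong to $E$, the solution given by the solver takes values in $E$ for a.e. $x\in\mathbb R$ (including the one-sided traces at $x=0$).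
   Formalization: It is additionally assumed that I_2 is nonempty for all states in D with v^r ≤ w^l (equivalently, p is unbounded), so that ρ^m = max I_2 and the Riemann solver are defined on all of D×D; for bounded p the solver is undefined for some data and the equivalence can fail. *)

theory Defs
  imports "HOL-Analysis.Analysis"
begin

definition strictly_convex_on :: "real set \<Rightarrow> (real \<Rightarrow> real) \<Rightarrow> bool" where
  "strictly_convex_on S f \<longleftrightarrow> convex S \<and>
     (\<forall>x\<in>S. \<forall>y\<in>S. \<forall>t. x \<noteq> y \<longrightarrow> 0 < t \<longrightarrow> t < 1 \<longrightarrow>
        f ((1 - t) * x + t * y) < (1 - t) * f x + t * f y)"

(* Functions of the density are total on the reals, but only their restriction to the half-line
   is meaningful; derivatives are therefore taken within it (one-sided at 0). *)

definition hderiv :: "(real \<Rightarrow> real) \<Rightarrow> real \<Rightarrow> real" where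
  "hderiv f x = vector_derivative f (at x within {0..})"

definition C2_halfline :: "(real \<Rightarrow> real) \<Rightarrow> bool" where
  "C2_halfline f \<longleftrightarrow>
     f differentiable_on {0..} \<and>
     hderiv f differentiable_on {0..} \<and>
     continuous_on {0..} (hderiv (hderiv f))"

definition pressure_law :: "(real \<Rightarrow> real) \<Rightarrow> bool" where
  "pressure_law p \<longleftrightarrow>
     C2_halfline p \<and>
     (\<forall>\<rho>\<ge>0. p \<rho> \<ge> 0) \<and>
     p 0 = 0 \<and>
     (\<forall>\<rho>>0. hderiv p \<rho> > 0) \<and>
     strictly_convex_on {0..} (\<lambda>\<rho>. \<rho> * p \<rho>)"

type_synonym state = "real \<times> real"  (* (density, velocity) *)

definition states :: "state set" where
  "states = {0..} \<times> {0..}"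

definition f1 :: "state \<Rightarrow> real" where
  "f1 u = fst u * snd u"

definition lambda1 :: "(real \<Rightarrow> real) \<Rightarrow> state \<Rightarrow> real" where
  "lambda1 p u = snd u - fst u * hderiv p (fst u)"

definition wcoord :: "(real \<Rightarrow> real) \<Rightarrow> state \<Rightarrow> real" where
  "wcoord p u = snd u + p (fst u)"

definition I2 :: "(real \<Rightarrow> real) \<Rightarrow> state \<Rightarrow> state \<Rightarrow> real set" where
  "I2 p l r = {\<rho>. \<rho> \<ge> 0 \<and> wcoord p l - p \<rho> = snd r}"

definition mid_state :: "(real \<Rightarrow> real) \<Rightarrow> state \<Rightarrow> state \<Rightarrow> state" where
  "mid_state p l r = ((GREATEST \<rho>. \<rho> \<in> I2 p l r), snd r)"

(* The maximum of I2 defining the intermediate state exists whenever it is used. A pressure law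
   alone does not ensure this: \<rho> / (1 + \<rho>) is one, but it is bounded. *)

definition RS_well_defined :: "(real \<Rightarrow> real) \<Rightarrow> bool" where
  "RS_well_defined p \<longleftrightarrow>
     (\<forall>l\<in>states. \<forall>r\<in>states. snd r \<le> wcoord p l \<longrightarrow> I2 p l r \<noteq> {})"

definition rarefaction :: "(real \<Rightarrow> real) \<Rightarrow> real \<Rightarrow> real \<Rightarrow> real \<Rightarrow> real \<Rightarrow> state" where
  "rarefaction p w a b x =
     (let \<rho> = (THE \<rho>. a \<le> \<rho> \<and> \<rho> \<le> b \<and> lambda1 p (\<rho>, w - p \<rho>) = x)
      in (\<rho>, w - p \<rho>))"

(* Riemann solutions are functions of x defined almost everywhere; the values given to RS and RSq1
   at the finitely many jump points are an arbitrary convention. *)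

definition RS :: "(real \<Rightarrow> real) \<Rightarrow> state \<Rightarrow> state \<Rightarrow> real \<Rightarrow> state" where
  "RS p l r x =
    (let w = wcoord p l; m = mid_state p l r in
     if snd r \<le> snd l then
       (if fst m \<noteq> fst l then
          (let \<sigma> = (fst m * snd m - fst l * snd l) / (fst m - fst l) in
           if x < \<sigma> then l else if x < snd r then m else r)
        else (if x < snd r then l else r))
     else if snd r \<le> w then
       (if x < lambda1 p l then l
        else if x \<le> lambda1 p m then rarefaction p w (fst m) (fst l) x
        else if x < snd r then m
        else r)
     else
       (if x < lambda1 p l then l
        else if x \<le> w then rarefaction p w 0 (fst l) x
        else if x < snd r then (0, x)
        else r))"

(* The traces at 0 themselves may differ (stationary waves); only their fluxes agree. *)

definition flux_at_0 :: "(real \<Rightarrow> state) \<Rightarrow> real" where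
  "flux_at_0 U = (THE c. \<exists>ul ur. (U \<longlongrightarrow> ul) (at_left 0) \<and> (U \<longlongrightarrow> ur) (at_right 0) \<and>
     f1 ul = c \<and> f1 ur = c)"

definition I1 :: "(real \<Rightarrow> real) \<Rightarrow> real \<Rightarrow> state \<Rightarrow> real set" where
  "I1 p q l = {\<rho>. \<rho> \<ge> 0 \<and> \<rho> * (wcoord p l - p \<rho>) = q}"

definition hat_state :: "(real \<Rightarrow> real) \<Rightarrow> real \<Rightarrow> state \<Rightarrow> state" where
  "hat_state p q l = (let \<rho> = (GREATEST \<rho>. \<rho> \<in> I1 p q l) in (\<rho>, q / \<rho>))"

definition check_state :: "(real \<Rightarrow> real) \<Rightarrow> real \<Rightarrow> state \<Rightarrow> state" where
  "check_state p q l = (let \<rho> = (LEAST \<rho>. \<rho> \<in> I1 p q l) in (\<rho>, q / \<rho>))"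

definition RSq1 :: "(real \<Rightarrow> real) \<Rightarrow> real \<Rightarrow> state \<Rightarrow> state \<Rightarrow> real \<Rightarrow> state" where
  "RSq1 p q l r =
    (if flux_at_0 (RS p l r) \<le> q then RS p l r
     else (\<lambda>x. if x < 0 then RS p l (hat_state p q l) x
               else RS p (check_state p q l) r x))"

definition invariant_for :: "(state \<Rightarrow> state \<Rightarrow> real \<Rightarrow> state) \<Rightarrow> state set \<Rightarrow> bool" where
  "invariant_for S E \<longleftrightarrow>
     (\<forall>l\<in>E. \<forall>r\<in>E.
        (AE x in lborel. S l r x \<in> E) \<and>
        (\<exists>u\<in>E. (S l r \<longlongrightarrow> u) (at_left 0)) \<and>
        (\<exists>u\<in>E. (S l r \<longlongrightarrow> u) (at_right 0)))"

definition inv_region :: "(real \<Rightarrow> real) \<Rightarrow> real \<Rightarrow> real \<Rightarrow> real \<Rightarrow> real \<Rightarrow> state set" where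
  "inv_region p v1 v2 w1 w2 =
     {u \<in> states. v1 \<le> snd u \<and> snd u \<le> v2 \<and> w1 \<le> wcoord p u \<and> wcoord p u \<le> w2}"

definition hq :: "(real \<Rightarrow> real) \<Rightarrow> real \<Rightarrow> real \<Rightarrow> real" where
  "hq p q v = p (q / v) + v"

end

theory Submission
  imports Defs
begin

text \<open>
  Write \<open>w = v + p \<rho>\<close>. Every wave of the first family (shock or rarefaction) keeps \<open>w\<close> fixed and
  moves \<open>v\<close> monotonically from \<open>v\<^sup>l\<close> towards \<open>v\<^sup>r\<close>, every contact keeps \<open>v\<close> fixed, and in a vacuum
  \<open>w = v\<close> lies between \<open>w\<^sup>l\<close> and \<open>v\<^sup>r\<close>. Hence a rectangle in the coordinates \<open>(v, w)\<close> is
  invariant for the classical solver (\<open>RS_in_inv_region\<close>), and only the states \<open>hat_state\<close> and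
  \<open>check_state\<close> inserted by the constraint can leave it. These two states lie on the curve
  \<open>\<rho> v = q\<close>, which in the coordinates \<open>(v, w)\<close> is the graph \<open>w = h\<^sub>q(v)\<close>, and they have
  \<open>w = w\<^sup>l\<close>.

  Sufficiency: \<open>h\<^sub>q\<close> is convex, being \<open>v\<close> plus the perspective of the convex function
  \<open>\<rho> \<mapsto> \<rho> p \<rho>\<close> (\<open>hq_convex\<close>). If its values at both ends of \<open>[v1, v2]\<close> are at least \<open>w2\<close> and some
  value in between is smaller, then \<open>h\<^sub>q \<le> w2\<close> forces \<open>v\<close> into \<open>[v1, v2]\<close> (\<open>sublevel_hq\<close>). Since
  \<open>w\<^sup>l \<le> w2\<close>, both inserted states belong to the rectangle, and the constrained solution consists
  of two pieces of classical solutions with data in it.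

  Necessity: if \<open>h\<^sub>q(v) < w2\<close> at a corner \<open>v \<in> {v1, v2}\<close>, then the state of velocity \<open>v\<close> on
  \<open>w = w2\<close> has flux larger than \<open>q\<close>. Taken as both left and right state, it is separated from the
  traces of the constrained solution by shocks that move away from the origin; the left trace
  is slower than \<open>v\<close> and the right trace is faster (\<open>RSq1_constant_data\<close>), so one of them leaves
  \<open>[v1, v2]\<close>.

  What turns this into a proof is the existence of the traces at \<open>0\<close> of a classical
  solution, the equality of their fluxes and the fact that they satisfy \<open>w = w\<^sup>l\<close> (\<open>RS_traces\<close>):
  the last point, together with the intermediate value theorem along the curve of constant \<open>w\<close>,
  shows that \<open>hat_state\<close> and \<open>check_state\<close> exist as soon as the constraint is violated
  (\<open>hat_check_state\<close>).
\<close>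

section \<open>Strictly convex functions\<close>

text \<open>
  The derivative is one-sided when \<open>a\<close> is an endpoint of \<open>S\<close>; for the half-line this covers the
  vacuum \<open>\<rho> = 0\<close>. The difference quotients along the segment from \<open>a\<close> towards a point lie below
  its chord slope, so in the limit the tangent lies weakly below that point. Applied to the
  midpoint \<open>c\<close> of \<open>a\<close> and \<open>b\<close>, which itself lies strictly below the chord, this gives a strict
  inequality at \<open>b\<close>.
\<close>

lemma strictly_convex_above_tangent:
  assumes conv: "strictly_convex_on S F" and ab: "a \<in> S" "b \<in> S" "a \<noteq> b"
    and D: "(F has_real_derivative D) (at a within S)"
  shows "F a + D * (b - a) < F b"
proof -
  define c where "c = (a + b) / 2"
  have S: "convex S" using conv by (simp add: strictly_convex_on_def)
  have seg: "(1 - t) * x + t * y \<in> S" if "x \<in> S" "y \<in> S" "0 \<le> t" "t \<le> 1" for x y t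
    using convexD[OF S that(1,2), of "1 - t" t] that by simp
  have F_less: "F ((1 - t) * x + t * y) < (1 - t) * F x + t * F y"
    if "x \<in> S" "y \<in> S" "x \<noteq> y" "0 < t" "t < 1" for x y t
    using conv that unfolding strictly_convex_on_def by blast
  have cS: "c \<in> S" using seg[OF ab(1,2), of "1/2"] by (simp add: c_def field_simps)
  have ca: "a \<noteq> c" using ab(3) by (simp add: c_def field_simps)
  have Fc: "F c < (F a + F b) / 2"
    using F_less[OF ab, of "1/2"] by (simp add: c_def field_simps)
  define \<phi> where "\<phi> t = F (a + t * (c - a))" for t
  have "((\<lambda>t. a + t * (c - a)) has_real_derivative (c - a)) (at 0 within {0..1})"
    by (auto intro!: derivative_eq_intros)
  moreover have "(\<lambda>t. a + t * (c - a)) ` {0..1} \<subseteq> S"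
    using seg[OF ab(1) cS] by (auto simp: algebra_simps)
  hence "(F has_real_derivative D) (at (a + 0 * (c - a)) within (\<lambda>t. a + t * (c - a)) ` {0..1})"
    using D by (auto intro: DERIV_subset)
  ultimately have "(\<phi> has_real_derivative D * (c - a)) (at 0 within {0..1})"
    using DERIV_image_chain[of F D "\<lambda>t. a + t * (c - a)" 0 "{0..1}" "c - a"]
    by (simp add: \<phi>_def[abs_def] o_def)
  hence lim: "((\<lambda>t. (\<phi> t - \<phi> 0) / (t - 0)) \<longlongrightarrow> D * (c - a)) (at_right 0)"
    by (simp add: has_field_derivative_iff at_within_Icc_at_right)
  have "(\<phi> t - \<phi> 0) / (t - 0) \<le> F c - F a" if t: "0 < t" "t < 1" for t
  proof -
    have "\<phi> t < (1 - t) * F a + t * F c"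
      using F_less[OF ab(1) cS ca t] by (simp add: \<phi>_def algebra_simps)
    hence "\<phi> t - \<phi> 0 \<le> (F c - F a) * t" by (simp add: \<phi>_def algebra_simps)
    thus ?thesis using t by (simp add: pos_divide_le_eq)
  qed
  hence "\<forall>\<^sub>F t in at_right 0. (\<phi> t - \<phi> 0) / (t - 0) \<le> F c - F a"
    unfolding eventually_at_right_field by (intro exI[of _ 1]) auto
  from tendsto_upperbound[OF lim this] have "D * (c - a) \<le> F c - F a" by simp
  moreover have "D * (c - a) = D * (b - a) / 2" by (simp add: c_def field_simps)
  ultimately show ?thesis using Fc by argo
qed

lemma strictly_convex_deriv_less:
  assumes conv: "strictly_convex_on S F" and ab: "a \<in> S" "b \<in> S" "a < b"
    and "(F has_real_derivative Da) (at a within S)" "(F has_real_derivative Db) (at b within S)"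
  shows "Da < Db"
proof -
  have "F a + Da * (b - a) < F b" "F b + Db * (a - b) < F a"
    using strictly_convex_above_tangent[OF conv] assms by auto
  hence "Da * (b - a) < Db * (b - a)" by (simp add: algebra_simps)
  thus ?thesis using ab(3) by simp
qed

text \<open>
  The endpoint \<open>z\<close> has positive weight in \<open>y \<noteq> x\<close>, so its strict inequality survives.
\<close>

lemma convex_below_between:
  fixes h :: "real \<Rightarrow> real"
  assumes conv: "convex_on S h" and "x \<in> S" "z \<in> S" "h x \<le> c" "h z < c"
    and y: "y \<in> closed_segment x z" "y \<noteq> x"
  shows "h y < c"
proof -
  obtain t where t: "0 \<le> t" "t \<le> 1" "y = (1 - t) * x + t * z"
    using y by (auto simp: closed_segment_def)
  have "t \<noteq> 0" using t y by auto
  have "h y \<le> (1 - t) * h x + t * h z"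
    using convex_onD[OF conv, of t x z] t assms by simp
  also have "\<dots> < (1 - t) * c + t * c"
    using t \<open>t \<noteq> 0\<close> assms by (intro add_le_less_mono mult_left_mono mult_strict_left_mono) auto
  finally show ?thesis by (simp add: algebra_simps)
qed

section \<open>The pressure and the first characteristic speed\<close>

locale aw_rascle =
  fixes p :: "real \<Rightarrow> real"
  assumes pressure: "pressure_law p" and well_defined: "RS_well_defined p"
begin

lemma p_0: "p 0 = 0" and p_nonneg: "0 \<le> \<rho> \<Longrightarrow> 0 \<le> p \<rho>"
  using pressure by (auto simp: pressure_law_def)

lemma p_deriv: "0 \<le> \<rho> \<Longrightarrow> (p has_real_derivative hderiv p \<rho>) (at \<rho> within {0..})"
  using pressure
  by (auto simp: pressure_law_def C2_halfline_def differentiable_on_def hderiv_def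
      has_real_derivative_iff_has_vector_derivative vector_derivative_works)

lemma p_continuous: "continuous_on {0..} p" and hderiv_continuous: "continuous_on {0..} (hderiv p)"
  using pressure
  by (auto simp: pressure_law_def C2_halfline_def intro: differentiable_imp_continuous_on)

lemma p_less: assumes "0 \<le> a" "a < b" shows "p a < p b"
proof (rule DERIV_pos_imp_increasing_open[OF assms(2)])
  show "continuous_on {a..b} p" using assms by (auto intro: continuous_on_subset[OF p_continuous])
  fix x assume "a < x" "x < b"
  hence x: "0 < x" using assms by simp
  have "at x within {0..} = at x" using at_within_interior[of x "{0..}"] x by simp
  moreover have "0 < hderiv p x" using x pressure by (auto simp: pressure_law_def)
  ultimately show "\<exists>y. DERIV p x :> y \<and> 0 < y" using p_deriv[of x] x by auto
qed

lemma p_less_iff: "0 \<le> a \<Longrightarrow> 0 \<le> b \<Longrightarrow> p a < p b \<longleftrightarrow> a < b"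
  using p_less[of a b] p_less[of b a] by (cases a b rule: linorder_cases) auto

lemma p_le_iff: "0 \<le> a \<Longrightarrow> 0 \<le> b \<Longrightarrow> p a \<le> p b \<longleftrightarrow> a \<le> b"
  using p_less_iff[of b a] by linarith

lemma p_eq_iff: "0 \<le> a \<Longrightarrow> 0 \<le> b \<Longrightarrow> p a = p b \<longleftrightarrow> a = b"
  using p_less_iff[of a b] p_less_iff[of b a] by (cases a b rule: linorder_cases) auto

text \<open>
  The density with pressure \<open>y\<close> is the intermediate density of the Riemann problem from the
  vacuum with velocity \<open>y\<close> to the vacuum at rest.
\<close>

lemma p_surj: assumes "0 \<le> y" obtains \<rho> where "0 \<le> \<rho>" "p \<rho> = y"
proof -
  have "I2 p (0, y) (0, 0) \<noteq> {}"
    using well_defined assms by (auto simp: RS_well_defined_def states_def wcoord_def p_0)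
  thus ?thesis using that by (auto simp: I2_def wcoord_def p_0)
qed

text \<open>
  Genuine nonlinearity: on a curve of constant \<open>w\<close> the characteristic speed is \<open>w\<close> minus the
  derivative of \<open>\<rho> p \<rho>\<close>, so strict convexity makes it strictly decreasing, up to the vacuum.
\<close>

lemma lambda1_less:
  assumes "0 \<le> a" "a < b"
  shows "lambda1 p (b, w - p b) < lambda1 p (a, w - p a)"
proof -
  have D: "((\<lambda>\<rho>. \<rho> * p \<rho>) has_real_derivative (p \<rho> + \<rho> * hderiv p \<rho>)) (at \<rho> within {0..})"
    if "0 \<le> \<rho>" for \<rho>
    by (rule derivative_eq_intros p_deriv[OF that] refl)+ simp
  have "strictly_convex_on {0..} (\<lambda>\<rho>. \<rho> * p \<rho>)" using pressure by (simp add: pressure_law_def)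
  from strictly_convex_deriv_less[OF this _ _ assms(2) D D]
  have "p a + a * hderiv p a < p b + b * hderiv p b" using assms by simp
  thus ?thesis by (simp add: lambda1_def)
qed

lemma lambda1_continuous: "continuous_on {0..} (\<lambda>\<rho>. lambda1 p (\<rho>, w - p \<rho>))"
  unfolding lambda1_def fst_conv snd_conv
  by (intro continuous_intros p_continuous hderiv_continuous)

section \<open>Rarefaction waves\<close>

lemma rarefaction_lambda1:
  assumes "0 \<le> a" "a \<le> \<rho>" "\<rho> \<le> b"
  shows "rarefaction p w a b (lambda1 p (\<rho>, w - p \<rho>)) = (\<rho>, w - p \<rho>)"
proof -
  have "(THE s. a \<le> s \<and> s \<le> b \<and> lambda1 p (s, w - p s) = lambda1 p (\<rho>, w - p \<rho>)) = \<rho>"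
  proof (rule the_equality)
    fix s assume s: "a \<le> s \<and> s \<le> b \<and> lambda1 p (s, w - p s) = lambda1 p (\<rho>, w - p \<rho>)"
    thus "s = \<rho>" using lambda1_less[of s \<rho> w] lambda1_less[of \<rho> s w] assms
      by (cases s \<rho> rule: linorder_cases) auto
  qed (use assms in auto)
  thus ?thesis by (simp add: rarefaction_def Let_def)
qed

lemma lambda1_image:
  assumes "0 \<le> a" "a \<le> b"
  shows "(\<lambda>\<rho>. lambda1 p (\<rho>, w - p \<rho>)) ` {a..b} = {lambda1 p (b, w - p b)..lambda1 p (a, w - p a)}"
    (is "?f ` _ = _")
proof
  have le: "?f t \<le> ?f s" if "0 \<le> s" "s \<le> t" for s t
    using lambda1_less[of s t w] that by (cases "s = t") auto
  show "?f ` {a..b} \<subseteq> {?f b..?f a}" using assms by (auto intro!: le)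
  show "{?f b..?f a} \<subseteq> ?f ` {a..b}"
  proof
    fix x assume "x \<in> {?f b..?f a}"
    moreover have "continuous_on {a..b} ?f"
      using assms by (auto intro: continuous_on_subset[OF lambda1_continuous])
    ultimately show "x \<in> ?f ` {a..b}"
      using IVT2'[of ?f b x a] assms by force
  qed
qed

lemma rarefaction_state:
  assumes "0 \<le> a" "a \<le> b" "lambda1 p (b, w - p b) \<le> x" "x \<le> lambda1 p (a, w - p a)"
  obtains \<rho> where "a \<le> \<rho>" "\<rho> \<le> b" "rarefaction p w a b x = (\<rho>, w - p \<rho>)"
proof -
  have "x \<in> (\<lambda>\<rho>. lambda1 p (\<rho>, w - p \<rho>)) ` {a..b}" using assms by (simp add: lambda1_image)
  thus ?thesis using that rarefaction_lambda1[OF assms(1)] by auto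
qed

text \<open>
  The density in the fan is the inverse of the continuous injective function \<open>lambda1\<close> on the
  compact interval \<open>{a..b}\<close>.
\<close>

lemma rarefaction_continuous:
  assumes "0 \<le> a" "a \<le> b"
  shows "continuous_on {lambda1 p (b, w - p b)..lambda1 p (a, w - p a)} (rarefaction p w a b)"
proof -
  let ?f = "\<lambda>\<rho>. lambda1 p (\<rho>, w - p \<rho>)"
  have "continuous_on (?f ` {a..b}) (fst \<circ> rarefaction p w a b)"
  proof (rule continuous_on_inv)
    show "continuous_on {a..b} ?f"
      using assms by (auto intro: continuous_on_subset[OF lambda1_continuous])
  qed (use assms rarefaction_lambda1 in auto)
  hence c: "continuous_on {?f b..?f a} (\<lambda>x. fst (rarefaction p w a b x))"
    using assms by (simp add: lambda1_image o_def)
  have "continuous_on {?f b..?f a} (\<lambda>x. p (fst (rarefaction p w a b x)))"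
  proof (rule continuous_on_compose2[OF p_continuous c])
    have "0 \<le> fst (rarefaction p w a b x)" if "x \<in> {?f b..?f a}" for x
      by (rule rarefaction_state[OF assms, of w x]) (use that assms in auto)
    thus "(\<lambda>x. fst (rarefaction p w a b x)) ` {?f b..?f a} \<subseteq> {0..}" by auto
  qed
  hence "continuous_on {?f b..?f a}
    (\<lambda>x. (fst (rarefaction p w a b x), w - p (fst (rarefaction p w a b x))))"
    by (intro continuous_intros c)
  thus ?thesis by (simp add: rarefaction_def Let_def)
qed

text \<open>
  A rarefaction joins its two end states continuously: the three branches are a single
  continuous profile evaluated at \<open>x\<close> clamped to the range of speeds. The bound \<open>c\<close> is the place
  where the next wave starts: the contact at \<open>v\<^sup>r\<close> or, if the fan ends at density \<open>0\<close>, the vacuum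
  at \<open>w\<^sup>l\<close>.
\<close>

lemma rarefaction_fan_continuous:
  fixes w a b :: real
  defines "f \<equiv> \<lambda>\<rho>. lambda1 p (\<rho>, w - p \<rho>)"
  assumes ab: "0 \<le> a" "a \<le> b" and U: "\<And>x. x < c \<Longrightarrow> U x =
     (if x < f b then (b, w - p b) else if x \<le> f a then rarefaction p w a b x else (a, w - p a))"
    and x: "x < c"
  shows "isCont U x"
proof -
  have fab: "f b \<le> f a"
    using lambda1_less[of a b w] ab by (cases "a = b") (auto simp: f_def)
  define R where "R = (\<lambda>x. rarefaction p w a b (max (f b) (min (f a) x)))"
  have "continuous_on UNIV R"
    unfolding R_def
  proof (rule continuous_on_compose2[OF rarefaction_continuous[OF ab, of w]])
    show "continuous_on UNIV (\<lambda>x. max (f b) (min (f a) x))" by (intro continuous_intros)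
  qed (use fab in \<open>auto simp: f_def\<close>)
  hence "isCont R x" by (simp add: continuous_on_eq_continuous_at)
  moreover have "U y = R y" if "y < c" for y
    using U[OF that] fab rarefaction_lambda1[OF ab(1), of b b w] rarefaction_lambda1[OF ab(1), of a b w] ab
    by (auto simp: R_def f_def max_def min_def)
  hence "\<forall>\<^sub>F y in nhds x. U y = R y"
    using x by (auto simp: eventually_nhds intro!: exI[of _ "{..<c}"])
  ultimately show ?thesis by (simp add: isCont_cong)
qed

section \<open>The classical Riemann solver\<close>

lemma mid_state_eqI:
  assumes "0 \<le> fst u" "wcoord p u = wcoord p l" "snd u = snd r"
  shows "mid_state p l r = u"
proof -
  have "wcoord p l - p x = snd r \<longleftrightarrow> p x = p (fst u)" for x
    using assms by (auto simp: wcoord_def)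
  hence "I2 p l r = {fst u}" using assms(1) p_eq_iff by (auto simp: I2_def)
  hence "(GREATEST \<rho>. \<rho> \<in> I2 p l r) = fst u" by (auto intro: Greatest_equality)
  thus ?thesis using assms by (simp add: mid_state_def prod_eq_iff)
qed

lemma mid_state:
  assumes "snd r \<le> wcoord p l"
  shows "0 \<le> fst (mid_state p l r)" "snd (mid_state p l r) = snd r"
    "wcoord p (mid_state p l r) = wcoord p l"
proof -
  obtain \<rho> where "0 \<le> \<rho>" "p \<rho> = wcoord p l - snd r" using p_surj[of "wcoord p l - snd r"] assms by auto
  with mid_state_eqI[of "(\<rho>, snd r)" l r] show "0 \<le> fst (mid_state p l r)"
    "snd (mid_state p l r) = snd r" "wcoord p (mid_state p l r) = wcoord p l"
    by (auto simp: wcoord_def)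
qed

text \<open>
  Inside a rarefaction \<open>w\<close> is constant and \<open>v\<close> runs between two admissible velocities; inside a
  vacuum \<open>v = w = x\<close> lies between \<open>w\<^sup>l\<close> and \<open>v\<^sup>r\<close>. All other values are \<open>l\<close>, \<open>r\<close> or the
  intermediate state, which combines \<open>w\<^sup>l\<close> with \<open>v\<^sup>r\<close>.
\<close>

lemma RS_in_inv_region:
  assumes "0 \<le> v1" and l: "l \<in> inv_region p v1 v2 w1 w2" and r: "r \<in> inv_region p v1 v2 w1 w2"
  shows "RS p l r x \<in> inv_region p v1 v2 w1 w2"
proof -
  let ?E = "inv_region p v1 v2 w1 w2" and ?w = "wcoord p l" and ?m = "mid_state p l r"
  have inE: "(\<rho>, ?w - p \<rho>) \<in> ?E" if "0 \<le> \<rho>" "v1 \<le> ?w - p \<rho>" "?w - p \<rho> \<le> v2" for \<rho>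
    using that l assms(1) by (auto simp: inv_region_def states_def wcoord_def)
  have lw: "l = (fst l, ?w - p (fst l))" by (simp add: prod_eq_iff wcoord_def)
  have l0: "0 \<le> fst l" using l by (auto simp: inv_region_def states_def)
  have v: "v1 \<le> snd l" "snd l \<le> v2" "v1 \<le> snd r" "snd r \<le> v2" "w1 \<le> ?w" "?w \<le> w2"
    using l r by (auto simp: inv_region_def)
  have mw: "?m = (fst ?m, ?w - p (fst ?m))" if "snd r \<le> ?w"
    using mid_state[OF that] by (simp add: prod_eq_iff wcoord_def)
  have mE: "?m \<in> ?E" if "snd r \<le> ?w"
    using mid_state[OF that] l r by (auto simp: inv_region_def states_def mem_Times_iff)
  have lle: "snd l \<le> ?w" using p_nonneg[OF l0] by (simp add: wcoord_def)
  have rare: "rarefaction p ?w a (fst l) x \<in> ?E"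
    if a: "0 \<le> a" "a \<le> fst l" "?w - p a \<le> v2" "lambda1 p l \<le> x" "x \<le> lambda1 p (a, ?w - p a)" for a
  proof -
    obtain \<rho> where \<rho>: "a \<le> \<rho>" "\<rho> \<le> fst l" "rarefaction p ?w a (fst l) x = (\<rho>, ?w - p \<rho>)"
      using rarefaction_state[of a "fst l" ?w x] a lw by metis
    hence "p a \<le> p \<rho>" "p \<rho> \<le> p (fst l)" using a l0 by (simp_all add: p_le_iff)
    moreover have "?w - p (fst l) = snd l" by (simp add: wcoord_def)
    ultimately show ?thesis using \<rho> a v by (auto intro!: inE)
  qed
  consider (shock) "snd r \<le> snd l" | (fan) "snd l < snd r" "snd r \<le> ?w" | (vacuum) "?w < snd r" by linarith
  thus ?thesis
  proof cases
    case shock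
    thus ?thesis using l r mE lle by (auto simp: RS_def Let_def)
  next
    case fan
    have "fst ?m \<le> fst l"
      using mid_state[OF fan(2)] fan l0 p_le_iff[of "fst ?m" "fst l"] by (auto simp: wcoord_def)
    hence "rarefaction p ?w (fst ?m) (fst l) x \<in> ?E" if "lambda1 p l \<le> x" "x \<le> lambda1 p ?m"
      using rare[of "fst ?m"] mid_state[OF fan(2)] mw[OF fan(2)] that v by (simp add: wcoord_def)
    thus ?thesis using fan l r mE by (auto simp: RS_def Let_def)
  next
    case vacuum
    have "rarefaction p ?w 0 (fst l) x \<in> ?E" if "lambda1 p l \<le> x" "x \<le> ?w"
      using rare[of 0] that vacuum v l0 by (simp add: p_0 lambda1_def)
    moreover have "(0, x) \<in> ?E" if "?w < x" "x < snd r"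
      using that v r lle assms(1) p_nonneg[of "fst r"]
      by (auto simp: inv_region_def states_def wcoord_def p_0)
    ultimately show ?thesis using vacuum lle l r by (auto simp: RS_def Let_def)
  qed
qed

text \<open>
  As \<open>v\<^sup>r\<close> and \<open>w\<^sup>l\<close> are positive, contacts and vacua stay strictly to the right of the origin, so
  near \<open>0\<close> only the first family is seen and \<open>w = w\<^sup>l\<close> there. The solution is continuous at \<open>0\<close>
  except for a stationary shock, where \<open>\<sigma> = 0\<close> says that both fluxes agree. The traces are stated
  to be values of the solution, so that they lie in every set that contains all its values.
\<close>

lemma RS_traces:
  assumes l: "l \<in> states" and r: "0 < snd r" and w: "0 < wcoord p l"
  shows "(RS p l r \<longlongrightarrow> RS p l r 0) (at_right 0)"
    and "\<exists>u\<in>range (RS p l r). (RS p l r \<longlongrightarrow> u) (at_left 0) \<and> f1 u = f1 (RS p l r 0)"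
    and "wcoord p (RS p l r 0) = wcoord p l" and "0 \<le> fst (RS p l r 0)"
proof -
  let ?w = "wcoord p l" and ?m = "mid_state p l r" and ?U = "RS p l r"
  let ?P = "(?U \<longlongrightarrow> ?U 0) (at_right 0) \<and>
    (\<exists>u\<in>range ?U. (?U \<longlongrightarrow> u) (at_left 0) \<and> f1 u = f1 (?U 0)) \<and>
    wcoord p (?U 0) = ?w \<and> 0 \<le> fst (?U 0)"
  have lw: "(fst l, ?w - p (fst l)) = l" by (simp add: prod_eq_iff wcoord_def)
  have l0: "0 \<le> fst l" using l by (auto simp: states_def)
  have lle: "snd l \<le> ?w" using p_nonneg[OF l0] by (simp add: wcoord_def)
  have contI: ?P if "isCont ?U 0" "wcoord p (?U 0) = ?w" "0 \<le> fst (?U 0)"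
  proof -
    have "(?U \<longlongrightarrow> ?U 0) (at 0)" using that(1) by (simp add: isCont_def)
    hence "(?U \<longlongrightarrow> ?U 0) (at_right 0)" "(?U \<longlongrightarrow> ?U 0) (at_left 0)"
      by (auto simp: filterlim_at_split)
    thus ?thesis using that by auto
  qed
  have constI: ?P if "\<And>x. a < x \<Longrightarrow> x < b \<Longrightarrow> ?U x = u" "a < 0" "0 < b" "wcoord p u = ?w" "0 \<le> fst u"
    for a b u
  proof (rule contI)
    have "\<forall>\<^sub>F x in nhds 0. ?U x = u"
      using that by (auto simp: eventually_nhds intro!: exI[of _ "{a<..<b}"])
    thus "isCont ?U 0" by (simp add: isCont_cong)
  qed (use that in auto)
  consider (shock) "snd r \<le> snd l" | (fan) "snd l < snd r" "snd r \<le> ?w" | (vacuum) "?w < snd r"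
    by linarith
  hence ?P
  proof cases
    case shock
    have m: "0 \<le> fst ?m" "snd ?m = snd r" "wcoord p ?m = ?w" using mid_state[of r l] shock lle by auto
    show ?thesis
    proof (cases "fst ?m = fst l")
      case True
      show ?thesis
        by (rule constI[of "-1" "snd r" l]) (use True shock r l0 in \<open>auto simp: RS_def Let_def\<close>)
    next
      case False
      define \<sigma> where "\<sigma> = (fst ?m * snd ?m - fst l * snd l) / (fst ?m - fst l)"
      have U: "?U x = (if x < \<sigma> then l else if x < snd r then ?m else r)" for x
        using False shock by (simp add: RS_def Let_def \<sigma>_def)
      consider "\<sigma> < 0" | "0 < \<sigma>" | "\<sigma> = 0" by linarith
      thus ?thesis
      proof cases
        case 1
        show ?thesis by (rule constI[of \<sigma> "snd r" ?m]) (use 1 m r in \<open>auto simp: U\<close>)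
      next
        case 2
        show ?thesis by (rule constI[of "-1" \<sigma> l]) (use 2 l0 in \<open>auto simp: U\<close>)
      next
        case 3
        have U0: "?U 0 = ?m" using 3 r by (simp add: U)
        have "\<forall>\<^sub>F x in at_right 0. ?U x = ?m"
          using r 3 unfolding eventually_at_right_field by (auto simp: U)
        hence "(?U \<longlongrightarrow> ?m) (at_right 0)" by (rule tendsto_eventually)
        moreover have "\<forall>\<^sub>F x in at_left 0. ?U x = l"
          using 3 unfolding eventually_at_left_field by (auto simp: U intro!: exI[of _ "-1"])
        hence "(?U \<longlongrightarrow> l) (at_left 0)" by (rule tendsto_eventually)
        moreover have "l \<in> range ?U" using 3 by (auto simp: U intro!: image_eqI[of _ _ "-1"])
        moreover have "f1 l = f1 ?m" using 3 False by (simp add: \<sigma>_def f1_def)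
        ultimately show ?thesis using m U0 by (intro conjI bexI[of _ l]) simp_all
      qed
    qed
  next
    case fan
    have m: "0 \<le> fst ?m" "snd ?m = snd r" "wcoord p ?m = ?w" using mid_state[OF fan(2)] by auto
    hence mw: "(fst ?m, ?w - p (fst ?m)) = ?m" by (simp add: prod_eq_iff wcoord_def)
    have ml: "fst ?m \<le> fst l" using m fan l0 p_le_iff[of "fst ?m" "fst l"] by (auto simp: wcoord_def)
    have U: "?U x = (if x < lambda1 p l then l else if x \<le> lambda1 p ?m
        then rarefaction p ?w (fst ?m) (fst l) x else ?m)" if "x < snd r" for x
      using fan that by (auto simp: RS_def Let_def)
    show ?thesis
    proof (rule contI)
      show "isCont ?U 0"
        by (rule rarefaction_fan_continuous[of "fst ?m" "fst l" "snd r" _ ?w, OF m(1) ml])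
          (use U r in \<open>simp_all add: lw mw\<close>)
      have "?U 0 = l \<or> ?U 0 = ?m \<or> (\<exists>\<rho>\<ge>0. ?U 0 = (\<rho>, ?w - p \<rho>))"
        using U[OF r] rarefaction_state[OF m(1) ml, of ?w 0] m(1) unfolding lw mw
        by (smt (verit))
      thus "wcoord p (?U 0) = ?w" "0 \<le> fst (?U 0)" using m l0 by (auto simp: wcoord_def)
    qed
  next
    case vacuum
    have w0: "lambda1 p (0, ?w - p 0) = ?w" by (simp add: lambda1_def p_0)
    have U: "?U x = (if x < lambda1 p l then l else if x \<le> ?w
        then rarefaction p ?w 0 (fst l) x else (0, ?w - p 0))" if "x < ?w" for x
      using vacuum lle that by (auto simp: RS_def Let_def)
    show ?thesis
    proof (rule contI)
      show "isCont ?U 0"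
        by (rule rarefaction_fan_continuous[of 0 "fst l" ?w _ ?w, OF order_refl l0])
          (use U w in \<open>simp_all add: lw w0\<close>)
      have "?U 0 = l \<or> (\<exists>\<rho>\<ge>0. ?U 0 = (\<rho>, ?w - p \<rho>))"
        using U[OF w] rarefaction_state[OF order_refl l0, of ?w 0] w unfolding lw w0
        by (smt (verit))
      thus "wcoord p (?U 0) = ?w" "0 \<le> fst (?U 0)" using l0 by (auto simp: wcoord_def)
    qed
  qed
  thus "(RS p l r \<longlongrightarrow> RS p l r 0) (at_right 0)"
    and "\<exists>u\<in>range (RS p l r). (RS p l r \<longlongrightarrow> u) (at_left 0) \<and> f1 u = f1 (RS p l r 0)"
    and "wcoord p (RS p l r 0) = wcoord p l" and "0 \<le> fst (RS p l r 0)" by auto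
qed

lemma flux_at_0_RS:
  assumes "l \<in> states" "0 < snd r" "0 < wcoord p l"
  shows "flux_at_0 (RS p l r) = f1 (RS p l r 0)"
proof -
  note tr = RS_traces[OF assms]
  obtain u where u: "(RS p l r \<longlongrightarrow> u) (at_left 0)" "f1 u = f1 (RS p l r 0)" using tr(2) by blast
  show ?thesis
    unfolding flux_at_0_def
  proof (rule the_equality)
    show "\<exists>ul ur. (RS p l r \<longlongrightarrow> ul) (at_left 0) \<and> (RS p l r \<longlongrightarrow> ur) (at_right 0) \<and>
        f1 ul = f1 (RS p l r 0) \<and> f1 ur = f1 (RS p l r 0)" using u tr(1) by blast
    fix c assume "\<exists>ul ur. (RS p l r \<longlongrightarrow> ul) (at_left 0) \<and> (RS p l r \<longlongrightarrow> ur) (at_right 0) \<and>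
        f1 ul = c \<and> f1 ur = c"
    thus "c = f1 (RS p l r 0)" using tendsto_unique[OF _ tr(1)] by auto
  qed
qed

section \<open>The constrained Riemann solver\<close>

text \<open>
  Along the curve of constant \<open>w\<close> the flux \<open>\<rho> (w - p \<rho>)\<close> vanishes at \<open>\<rho> = 0\<close> and where
  \<open>p \<rho> = w\<close>. If it exceeds \<open>q\<close> at some \<open>\<rho>\<close>, the intermediate value theorem gives a root of flux
  \<open>q\<close> on either side, and compactness of the set of roots gives the extremal ones, which is all
  that the definite descriptions in \<open>hat_state\<close> and \<open>check_state\<close> need.
\<close>

lemma hat_check_state:
  assumes "0 < q" "0 \<le> \<rho>" "q < \<rho> * (wcoord p l - p \<rho>)"
  obtains a b where "0 < a" "a < \<rho>" "\<rho> < b"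
    "a * (wcoord p l - p a) = q" "b * (wcoord p l - p b) = q"
    "check_state p q l = (a, wcoord p l - p a)" "hat_state p q l = (b, wcoord p l - p b)"
proof -
  let ?w = "wcoord p l" and ?g = "\<lambda>\<rho>. \<rho> * (wcoord p l - p \<rho>)"
  have pos: "0 < s" "p s < ?w" if "0 \<le> s" "0 < ?g s" for s
    using that by (auto simp: zero_less_mult_iff)
  have "0 < ?w" using pos[of \<rho>] p_nonneg[of \<rho>] assms by auto
  then obtain R where R: "0 \<le> R" "p R = ?w" using p_surj[of ?w] by auto
  have below: "s < R" if "0 \<le> s" "0 < ?g s" for s using pos[OF that] R p_less_iff[of s R] that by simp
  have g: "continuous_on {s..t} ?g" if "0 \<le> s" for s t
    using that by (intro continuous_intros continuous_on_subset[OF p_continuous]) auto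
  have I1: "I1 p q l = {s \<in> {0..R}. ?g s = q}"
    using below assms(1) by (auto simp: I1_def less_imp_le)
  have "closed (I1 p q l)"
    unfolding I1 by (intro continuous_closed_preimage_constant g) auto
  moreover have "bounded (I1 p q l)" unfolding I1 by (rule bounded_subset[of "{0..R}"]) auto
  ultimately have cpt: "compact (I1 p q l)" by (simp add: compact_eq_bounded_closed)
  have \<rho>R: "\<rho> < R" using below[of \<rho>] assms by simp
  obtain s where s: "0 \<le> s" "s \<le> \<rho>" "?g s = q"
    using IVT'[of ?g 0 q \<rho>] g[of 0 \<rho>] assms by auto
  obtain t where t: "\<rho> \<le> t" "t \<le> R" "?g t = q"
    using IVT2'[of ?g R q \<rho>] g[of \<rho> R] assms R \<rho>R by auto
  have sI: "s \<in> I1 p q l" and tI: "t \<in> I1 p q l" using s t assms by (auto simp: I1_def)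
  obtain a where a: "a \<in> I1 p q l" "\<And>x. x \<in> I1 p q l \<Longrightarrow> a \<le> x"
    using compact_attains_inf[OF cpt] sI by blast
  obtain b where b: "b \<in> I1 p q l" "\<And>x. x \<in> I1 p q l \<Longrightarrow> x \<le> b"
    using compact_attains_sup[OF cpt] sI by blast
  have ga: "0 \<le> a" "?g a = q" and gb: "0 \<le> b" "?g b = q" using a(1) b(1) by (auto simp: I1_def)
  have a0: "0 < a" and b0: "0 < b" using pos(1)[of a] pos(1)[of b] ga gb assms(1) by auto
  have "a \<noteq> \<rho>" "b \<noteq> \<rho>" using ga gb assms(3) by auto
  hence ord: "a < \<rho>" "\<rho> < b" using a(2)[OF sI] b(2)[OF tI] s t by auto
  have "(LEAST x. x \<in> I1 p q l) = a" by (rule Least_equality) (use a in auto)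
  hence chk: "check_state p q l = (a, ?w - p a)" using ga a0 by (auto simp: check_state_def field_simps)
  have "(GREATEST x. x \<in> I1 p q l) = b" by (rule Greatest_equality) (use b in auto)
  hence hat: "hat_state p q l = (b, ?w - p b)" using gb b0 by (auto simp: hat_state_def field_simps)
  show ?thesis by (rule that[OF a0 ord ga(2) gb(2) chk hat])
qed

text \<open>
  With \<open>F \<rho> = \<rho> p \<rho>\<close>, \<open>p (q / v) = (v / q) F (q / v)\<close> is the perspective of \<open>F\<close>. A convex
  combination \<open>v\<close> of \<open>x\<close> and \<open>y\<close> with weight \<open>t\<close> corresponds to the combination \<open>q / v\<close> of \<open>q / x\<close>
  and \<open>q / y\<close> with the weight \<open>s\<close> proportional to \<open>t y\<close>, and the factor \<open>v / q\<close> turns it back.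
\<close>

lemma hq_convex:
  assumes "0 < q" shows "convex_on {0<..} (hq p q)"
proof (rule convex_onI)
  fix t x y :: real
  assume t: "0 < t" "t < 1" and "x \<in> {0<..}" "y \<in> {0<..}"
  hence x: "0 < x" and y: "0 < y" by auto
  define v where "v = (1 - t) * x + t * y"
  have v: "0 < v" using t x y by (simp add: v_def add_pos_pos)
  define s where "s = t * y / v"
  have s1: "1 - s = (1 - t) * x / v" using v by (simp add: s_def v_def field_simps)
  have s: "0 < s" "0 < 1 - s" using t x y v by (simp add: s_def) (use t x v in \<open>simp add: s1\<close>)
  have q: "q / v = (1 - s) * (q / x) + s * (q / y)"
    using v x y by (simp add: s1) (simp add: s_def field_simps)
  have sc: "strictly_convex_on {0..} (\<lambda>\<rho>. \<rho> * p \<rho>)" using pressure by (simp add: pressure_law_def)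
  have "((1 - s) * X + s * Y) * p ((1 - s) * X + s * Y) \<le> (1 - s) * (X * p X) + s * (Y * p Y)"
    if "0 \<le> X" "0 \<le> Y" for X Y
  proof (cases "X = Y")
    case True
    thus ?thesis by (simp add: algebra_simps)
  next
    case False
    thus ?thesis using sc s that unfolding strictly_convex_on_def by (intro less_imp_le) auto
  qed
  from this[of "q / x" "q / y"]
  have "q / v * p (q / v) \<le> (1 - s) * (q / x * p (q / x)) + s * (q / y * p (q / y))"
    unfolding q[symmetric] using x y assms by simp
  also have "\<dots> = q / v * ((1 - t) * p (q / x) + t * p (q / y))"
    using v x y by (simp add: s1) (simp add: s_def field_simps)
  finally have "p (q / v) \<le> (1 - t) * p (q / x) + t * p (q / y)"
    using v assms by (simp add: mult_le_cancel_left divide_pos_pos del: times_divide_eq_left)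
  thus "hq p q ((1 - t) *\<^sub>R x + t *\<^sub>R y) \<le> (1 - t) * hq p q x + t * hq p q y"
    by (simp add: hq_def v_def algebra_simps)
qed simp

text \<open>
  If \<open>v\<close> were outside, an endpoint of \<open>[v1, v2]\<close> would lie between \<open>v\<close> and \<open>z\<close>, and convexity
  would push its value below \<open>c\<close>.
\<close>

lemma sublevel_hq:
  assumes "0 < q" "0 < v1" "hq p q v1 \<ge> c" "hq p q v2 \<ge> c"
    and z: "z \<in> {v1..v2}" "hq p q z < c" and v: "0 < v" "hq p q v \<le> c"
  shows "v1 \<le> v \<and> v \<le> v2"
proof (rule ccontr)
  assume "\<not> (v1 \<le> v \<and> v \<le> v2)"
  then consider "v < v1" | "v2 < v" by linarith
  thus False
  proof cases
    case 1
    have "hq p q v1 < c"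
      by (rule convex_below_between[OF hq_convex[OF assms(1)], of v z])
        (use assms 1 in \<open>auto simp: closed_segment_eq_real_ivl\<close>)
    thus False using assms by simp
  next
    case 2
    have "hq p q v2 < c"
      by (rule convex_below_between[OF hq_convex[OF assms(1)], of v z])
        (use assms 2 in \<open>auto simp: closed_segment_eq_real_ivl\<close>)
    thus False using assms by simp
  qed
qed

lemma RSq1_invariant:
  assumes "0 < v1" "0 < w1" "0 < q" and hq: "hq p q v1 \<ge> w2" "hq p q v2 \<ge> w2"
    and z: "z \<in> {v1..v2}" "hq p q z < w2"
  shows "invariant_for (RSq1 p q) (inv_region p v1 v2 w1 w2)"
  unfolding invariant_for_def
proof (intro ballI)
  let ?E = "inv_region p v1 v2 w1 w2"
  have RS: "range (RS p l r) \<subseteq> ?E" if "l \<in> ?E" "r \<in> ?E" for l r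
    using RS_in_inv_region[OF less_imp_le[OF assms(1)] that] by blast
  have tr: "(RS p l r \<longlongrightarrow> RS p l r 0) (at_right 0)" "\<exists>u\<in>?E. (RS p l r \<longlongrightarrow> u) (at_left 0)"
    if "l \<in> ?E" "r \<in> ?E" for l r
  proof -
    have "l \<in> states" "0 < snd r" "0 < wcoord p l"
      using that assms by (auto simp: inv_region_def)
    note t = RS_traces[OF this]
    show "(RS p l r \<longlongrightarrow> RS p l r 0) (at_right 0)" by (rule t(1))
    show "\<exists>u\<in>?E. (RS p l r \<longlongrightarrow> u) (at_left 0)" using t(2) RS[OF that] by blast
  qed
  fix l r assume l: "l \<in> ?E" and r: "r \<in> ?E"
  show "(AE x in lborel. RSq1 p q l r x \<in> ?E) \<and> (\<exists>u\<in>?E. (RSq1 p q l r \<longlongrightarrow> u) (at_left 0)) \<and>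
      (\<exists>u\<in>?E. (RSq1 p q l r \<longlongrightarrow> u) (at_right 0))"
  proof (cases "flux_at_0 (RS p l r) \<le> q")
    case True
    hence "RSq1 p q l r = RS p l r" by (simp add: RSq1_def)
    thus ?thesis using RS[OF l r] tr[OF l r] by auto
  next
    case False
    let ?u = "RS p l r 0"
    have l': "l \<in> states" "0 < snd r" "0 < wcoord p l" "w1 \<le> wcoord p l" "wcoord p l \<le> w2"
      using l r assms by (auto simp: inv_region_def)
    have "snd ?u = wcoord p l - p (fst ?u)"
      using RS_traces(3)[OF l'(1-3)] by (simp add: wcoord_def)
    hence "q < fst ?u * (wcoord p l - p (fst ?u))"
      using False flux_at_0_RS[OF l'(1-3)] by (simp add: f1_def)
    then obtain a b where ab: "0 < a" "a < fst ?u" "fst ?u < b"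
      "a * (wcoord p l - p a) = q" "b * (wcoord p l - p b) = q"
      "check_state p q l = (a, wcoord p l - p a)" "hat_state p q l = (b, wcoord p l - p b)"
      using hat_check_state[OF assms(3), of "fst ?u" l] RS_traces(4)[OF l'(1-3)] by metis
    \<comment> \<open>A state of flux \<open>q\<close> on the curve \<open>w = w\<^sup>l\<close> satisfies \<open>h\<^sub>q(v) = w\<^sup>l \<le> w2\<close>.\<close>
    have inE: "(s, wcoord p l - p s) \<in> ?E" if s: "0 < s" "s * (wcoord p l - p s) = q" for s
    proof -
      let ?v = "wcoord p l - p s"
      have v: "0 < ?v" using s assms(3) by (metis zero_less_mult_pos)
      have "q / ?v = s" using s v by (simp add: field_simps)
      hence "hq p q ?v \<le> w2" using l' by (simp add: hq_def)
      from sublevel_hq[OF assms(3,1) hq z v this] show ?thesis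
        using s v l' by (simp add: inv_region_def states_def wcoord_def)
    qed
    have hat: "hat_state p q l \<in> ?E" and chk: "check_state p q l \<in> ?E"
      using ab inE[of a] inE[of b] by auto
    have U: "RSq1 p q l r = (\<lambda>x. if x < 0 then RS p l (hat_state p q l) x
               else RS p (check_state p q l) r x)" (is "_ = ?U") using False by (simp add: RSq1_def)
    have "?U x \<in> ?E" for x using RS[OF l hat] RS[OF chk r] by auto
    moreover obtain u where u: "u \<in> ?E" "(RS p l (hat_state p q l) \<longlongrightarrow> u) (at_left 0)"
      using tr(2)[OF l hat] by blast
    have "(?U \<longlongrightarrow> u) (at_left 0)"
      by (rule Lim_transform_eventually[OF u(2)]) (auto simp: eventually_at_filter)
    moreover have "(?U \<longlongrightarrow> RS p (check_state p q l) r 0) (at_right 0)"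
      by (rule Lim_transform_eventually[OF tr(1)[OF chk r]]) (auto simp: eventually_at_filter)
    moreover have "RS p (check_state p q l) r 0 \<in> ?E" using RS[OF chk r] by auto
    ultimately show ?thesis unfolding U using u(1) by blast
  qed
qed

text \<open>
  All states involved have the same \<open>w\<close>, so on each side the classical solution is a single shock.
  Its speed is the slope of a chord of the flux along the curve of constant \<open>w\<close>: the constant
  state carries more flux than \<open>q\<close>, so the shock to the denser state moves left, the shock from
  the thinner state moves right, and both inserted states remain visible at the origin.
\<close>

lemma RSq1_constant_data:
  assumes l: "0 < \<rho>" "0 < v" and q: "0 < q" "q < \<rho> * v"
  obtains a b where "a < \<rho>" "\<rho> < b"
    "(RSq1 p q (\<rho>, v) (\<rho>, v) \<longlongrightarrow> (b, v + p \<rho> - p b)) (at_left 0)"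
    "(RSq1 p q (\<rho>, v) (\<rho>, v) \<longlongrightarrow> (a, v + p \<rho> - p a)) (at_right 0)"
    "0 < a"
proof -
  let ?l = "(\<rho>, v)"
  have w: "wcoord p ?l = v + p \<rho>" by (simp add: wcoord_def)
  obtain a b where ab: "0 < a" "a < \<rho>" "\<rho> < b"
      "a * (v + p \<rho> - p a) = q" "b * (v + p \<rho> - p b) = q"
      "check_state p q ?l = (a, v + p \<rho> - p a)" "hat_state p q ?l = (b, v + p \<rho> - p b)"
    using hat_check_state[of q \<rho> ?l] assms unfolding w by auto
  have pab: "p a < p \<rho>" "p \<rho> < p b" using p_less[of a \<rho>] p_less[of \<rho> b] ab by auto
  have vb: "0 < v + p \<rho> - p b" using ab q l by (metis less_trans zero_less_mult_pos)
  have RS0: "RS p ?l ?l 0 = ?l"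
    using mid_state_eqI[of ?l ?l ?l] l by (simp add: RS_def Let_def)
  have "0 < wcoord p ?l" using l p_nonneg[of \<rho>] by (simp add: w)
  hence "flux_at_0 (RS p ?l ?l) = \<rho> * v"
    using flux_at_0_RS[of ?l ?l] l RS0 by (simp add: f1_def states_def)
  hence U: "RSq1 p q ?l ?l = (\<lambda>x. if x < 0 then RS p ?l (b, v + p \<rho> - p b) x
               else RS p (a, v + p \<rho> - p a) ?l x)" unfolding RSq1_def ab(6,7) using q by simp
  have mb: "mid_state p ?l (b, v + p \<rho> - p b) = (b, v + p \<rho> - p b)"
    by (rule mid_state_eqI) (use ab l in \<open>auto simp: wcoord_def\<close>)
  have ma: "mid_state p (a, v + p \<rho> - p a) ?l = ?l"
    by (rule mid_state_eqI) (use ab l in \<open>auto simp: wcoord_def\<close>)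
  have sb: "(q - \<rho> * v) / (b - \<rho>) < 0" using q ab by (simp add: divide_neg_pos)
  have sa: "0 < (\<rho> * v - q) / (\<rho> - a)" using q ab by simp
  have "RSq1 p q ?l ?l x = (b, v + p \<rho> - p b)" if "(q - \<rho> * v) / (b - \<rho>) < x" "x < 0" for x
    using that ab pab vb by (simp add: U RS_def Let_def mb)
  hence left: "\<forall>\<^sub>F x in at_left 0. RSq1 p q ?l ?l x = (b, v + p \<rho> - p b)"
    using sb unfolding eventually_at_left_field by blast
  have "RSq1 p q ?l ?l x = (a, v + p \<rho> - p a)" if "0 < x" "x < (\<rho> * v - q) / (\<rho> - a)" for x
    using that ab pab by (simp add: U RS_def Let_def ma)
  hence right: "\<forall>\<^sub>F x in at_right 0. RSq1 p q ?l ?l x = (a, v + p \<rho> - p a)"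
    using sa unfolding eventually_at_right_field by blast
  show ?thesis
    by (rule that[OF ab(2,3) tendsto_eventually[OF left] tendsto_eventually[OF right] ab(1)])
qed

text \<open>
  The state of velocity \<open>v\<close> with \<open>w = w2\<close> is denser than \<open>q / v\<close> when \<open>h\<^sub>q(v) < w2\<close>, so it violates
  the constraint.
\<close>

lemma hq_ge_if_invariant:
  assumes inv: "invariant_for (RSq1 p q) (inv_region p v1 v2 w1 w2)"
    and "0 < v1" "v1 \<le> v2" "w1 \<le> w2" "v2 < w2" "0 < q" and v: "v \<in> {v1, v2}"
  shows "w2 \<le> hq p q v"
proof (rule ccontr)
  let ?E = "inv_region p v1 v2 w1 w2"
  assume "\<not> w2 \<le> hq p q v"
  hence h: "p (q / v) < w2 - v" by (simp add: hq_def)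
  have v0: "0 < v" "v1 \<le> v" "v \<le> v2" "v < w2" using assms by auto
  obtain \<rho> where \<rho>: "0 \<le> \<rho>" "p \<rho> = w2 - v" using p_surj[of "w2 - v"] v0 by auto
  have less: "q / v < \<rho>" using h \<rho> p_less_iff[of "q / v" \<rho>] v0 assms(6) by simp
  hence q: "q < \<rho> * v" using v0 by (simp add: pos_divide_less_eq)
  have \<rho>0: "0 < \<rho>" using divide_pos_pos[OF assms(6) v0(1)] less by linarith
  have lE: "(\<rho>, v) \<in> ?E" using \<rho> v0 assms by (simp add: inv_region_def states_def wcoord_def)
  obtain a b where ab: "a < \<rho>" "\<rho> < b" "0 < a"
    "(RSq1 p q (\<rho>, v) (\<rho>, v) \<longlongrightarrow> (b, v + p \<rho> - p b)) (at_left 0)"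
    "(RSq1 p q (\<rho>, v) (\<rho>, v) \<longlongrightarrow> (a, v + p \<rho> - p a)) (at_right 0)"
    using RSq1_constant_data[OF \<rho>0 v0(1) assms(6) q] by metis
  obtain ul ur where "ul \<in> ?E" "(RSq1 p q (\<rho>, v) (\<rho>, v) \<longlongrightarrow> ul) (at_left 0)"
      "ur \<in> ?E" "(RSq1 p q (\<rho>, v) (\<rho>, v) \<longlongrightarrow> ur) (at_right 0)"
    using inv lE unfolding invariant_for_def by blast
  hence "(b, v + p \<rho> - p b) \<in> ?E" "(a, v + p \<rho> - p a) \<in> ?E"
    using tendsto_unique[OF trivial_limit_at_left_real ab(4)]
      tendsto_unique[OF trivial_limit_at_right_real ab(5)] by auto
  hence "v1 \<le> v + p \<rho> - p b" "v + p \<rho> - p a \<le> v2" by (auto simp: inv_region_def)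
  moreover have "p a < p \<rho>" "p \<rho> < p b" using p_less[of a \<rho>] p_less[of \<rho> b] ab by auto
  ultimately show False using v by auto
qed

end

theorem proposition3p2:
  fixes p :: "real \<Rightarrow> real" and v1 v2 w1 w2 q :: real
  assumes "pressure_law p"
    and "RS_well_defined p"
    and "0 < v1" and "v1 < v2"
    and "0 < w1" and "w1 < w2"
    and "v2 < w2"
    and "q > 0"
    and "\<exists>v\<in>{v1..v2}. hq p q v < w2"
  shows "invariant_for (RSq1 p q) (inv_region p v1 v2 w1 w2) \<longleftrightarrow>
    hq p q v1 \<ge> w2 \<and> hq p q v2 \<ge> w2"
proof -
  interpret aw_rascle p by unfold_locales (use assms in auto)
  show ?thesis
    using RSq1_invariant[of v1 w1 q w2 v2] hq_ge_if_invariant[of q v1 v2 w1 w2] assms by auto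
qed

end
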